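(* Let $\mathbb H^{m+1}=\mathbb R\times_{e^t}\mathbb R^m$ be the hyperbolic space of curvature $-1$ foliated by horospheres and let $X=e^t\partial_t\in\mathfrak X(\mathbb H^{m+1})$. Then 1. there exist no entire graphs $\psi_u:\mathbb R^m\to\mathbb H^{m+1}$ over the horosphere $\mathbb R^m$ which are mean curvature flow solitons with respect to $X$ with soliton constant $c\ge0$; 2. if $\psi_u:\mathbb R^m\to\mathbb H^{m+1}$ is an entire graph over the horosphere $\mathbb R^m$ which is a mean curvature flow soliton with respect to $X$ with soliton constant $c<0$, then $$\mathrm{dist}\Big(\psi_u(\mathbb R^m),\ \big\{t=\log\big(-\tfrac mc\big)\big\}\Big)=0.$$
   Context: $\mathbb R\times_{e^t}\mathbb R^m$ is $\mathbb R\times\mathbb R^m$ with metric $dt^2+e^{2t}\langle\,,\rangle_{\mathbb R^m}$. An entire graph over $\mathbb R^m$ is the immersion $x\mapsto(v(x),x)$ given by a smooth function $v:\mathbb R^m\to\mathbb R$ (the paper writes $\psi_u$ with $u=s(v)$, where $s(t)=\int_{t_0}^t e^{-\sigma}d\sigma$ is the flow parameter of $X$). It is a mean curvature flow soliton with respect to $X$ with soliton constant $c\in\mathbb R$ if $cX^\perp=m\mathbf H$ along it, with $X^\perp$ the normal component of $X$ and $\mathbf H=\frac1m\mathrm{tr}\,\mathrm{II}$ the normalized mean curvature vector. $\mathrm{dist}$ is the distance in $\mathbb H^{m+1}$ between sets. *)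

theory Defs
  imports "HOL-Analysis.Analysis"
begin

section \<open>Riemannian metrics on a Euclidean space\<close>

text \<open>A Riemannian metric on a Euclidean space \<open>'a\<close>, regarded as a manifold with one global
  chart: \<open>g p u v\<close> is the inner product of the tangent vectors \<open>u\<close>, \<open>v\<close> at \<open>p\<close>.\<close>

type_synonym 'a rmetric = "'a \<Rightarrow> 'a \<Rightarrow> 'a \<Rightarrow> real"

text \<open>\<open>levi_civita g p u v\<close> is the value at \<open>p\<close> of the Levi-Civita derivative of the constant
  field \<open>v\<close> in the direction \<open>u\<close> (the Christoffel symbols), given by the Koszul formula, where
  all brackets of constant fields vanish.\<close>

definition levi_civita :: "'a::euclidean_space rmetric \<Rightarrow> 'a \<Rightarrow> 'a \<Rightarrow> 'a \<Rightarrow> 'a" where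
  "levi_civita g p u v = (THE z. \<forall>w.
     2 * g p z w =
         frechet_derivative (\<lambda>q. g q v w) (at p) u
       + frechet_derivative (\<lambda>q. g q u w) (at p) v
       - frechet_derivative (\<lambda>q. g q u v) (at p) w)"

definition curve_length :: "'a::euclidean_space rmetric \<Rightarrow> (real \<Rightarrow> 'a) \<Rightarrow> real" where
  "curve_length g \<gamma> = integral {0..1} (\<lambda>s.
     sqrt (g (\<gamma> s) (vector_derivative \<gamma> (at s)) (vector_derivative \<gamma> (at s))))"

text \<open>The competitors are \<open>C\<^sup>1\<close> curves, possibly with zero velocity, so corners can be traversed by
  slowing down. \<open>piecewise_C1_differentiable_on\<close> would be wrong here: it does not bound the velocity
  near the exceptional points, and \<open>integral\<close> is \<open>0\<close> on the speed of a curve of infinite length.\<close>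

definition riem_dist :: "'a::euclidean_space rmetric \<Rightarrow> 'a \<Rightarrow> 'a \<Rightarrow> real" where
  "riem_dist g p q = Inf {curve_length g \<gamma> | \<gamma>.
     \<gamma> C1_differentiable_on {0..1} \<and> pathstart \<gamma> = p \<and> pathfinish \<gamma> = q}"

definition riem_setdist :: "'a::euclidean_space rmetric \<Rightarrow> 'a set \<Rightarrow> 'a set \<Rightarrow> real" where
  "riem_setdist g A B = Inf {riem_dist g p q | p q. p \<in> A \<and> q \<in> B}"

section \<open>Extrinsic geometry of immersions defined on \<open>\<real>\<^sup>m\<close>\<close>

definition normal_part ::
  "'a::euclidean_space rmetric \<Rightarrow> (real^'m \<Rightarrow> 'a) \<Rightarrow> real^'m \<Rightarrow> 'a \<Rightarrow> 'a" where
  "normal_part g \<psi> x w = (THE n.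
     (\<forall>a. g (\<psi> x) n (frechet_derivative \<psi> (at x) a) = 0) \<and>
     w - n \<in> range (frechet_derivative \<psi> (at x)))"

text \<open>The second fundamental form is the normal part of the ambient derivative, in the direction
  \<open>a\<close>, of the field \<open>d\<psi>(b)\<close> along \<open>\<psi>\<close>. For the constant fields \<open>a\<close>, \<open>b\<close> on \<open>\<real>\<^sup>m\<close> this
  derivative is \<open>D\<^sup>2\<psi>(a,b)\<close> plus a Christoffel term.\<close>

definition second_fundamental_form ::
  "'a::euclidean_space rmetric \<Rightarrow> (real^'m \<Rightarrow> 'a) \<Rightarrow> real^'m \<Rightarrow> real^'m \<Rightarrow> real^'m \<Rightarrow> 'a" where
  "second_fundamental_form g \<psi> x a b = normal_part g \<psi> x
     (frechet_derivative (\<lambda>y. frechet_derivative \<psi> (at y) b) (at x) a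
      + levi_civita g (\<psi> x) (frechet_derivative \<psi> (at x) a) (frechet_derivative \<psi> (at x) b))"

definition first_fundamental_matrix ::
  "'a::euclidean_space rmetric \<Rightarrow> (real^'m \<Rightarrow> 'a) \<Rightarrow> real^'m \<Rightarrow> real^'m^'m" where
  "first_fundamental_matrix g \<psi> x = (\<chi> i j.
     g (\<psi> x) (frechet_derivative \<psi> (at x) (axis i 1)) (frechet_derivative \<psi> (at x) (axis j 1)))"

text \<open>The trace is taken with respect to the induced metric, and is normalized by \<open>1/m\<close>.\<close>

definition mean_curvature_vector ::
  "'a::euclidean_space rmetric \<Rightarrow> (real^'m \<Rightarrow> 'a) \<Rightarrow> real^'m \<Rightarrow> 'a" where
  "mean_curvature_vector g \<psi> x = (1 / real CARD('m)) *\<^sub>R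
     (\<Sum>i\<in>UNIV. \<Sum>j\<in>UNIV. matrix_inv (first_fundamental_matrix g \<psi> x) $ i $ j *\<^sub>R
        second_fundamental_form g \<psi> x (axis i 1) (axis j 1))"

definition mcf_soliton ::
  "'a::euclidean_space rmetric \<Rightarrow> ('a \<Rightarrow> 'a) \<Rightarrow> real \<Rightarrow> (real^'m \<Rightarrow> 'a) \<Rightarrow> bool" where
  "mcf_soliton g X c \<psi> \<longleftrightarrow> (\<forall>x.
     c *\<^sub>R normal_part g \<psi> x (X (\<psi> x)) = real CARD('m) *\<^sub>R mean_curvature_vector g \<psi> x)"

section \<open>Smooth functions on \<open>\<real>\<^sup>m\<close>\<close>

fun C_k :: "nat \<Rightarrow> (real^'m \<Rightarrow> real) \<Rightarrow> bool" where
  "C_k 0 f \<longleftrightarrow> continuous_on UNIV f"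
| "C_k (Suc k) f \<longleftrightarrow> f differentiable_on UNIV \<and>
     (\<forall>a. C_k k (\<lambda>x. frechet_derivative f (at x) a))"

definition smooth :: "(real^'m \<Rightarrow> real) \<Rightarrow> bool" where
  "smooth f \<longleftrightarrow> (\<forall>k. C_k k f)"

section \<open>The warped product \<open>\<real> \<times>\<^bsub>exp\<^esub> \<real>\<^sup>m\<close>\<close>

text \<open>The metric \<open>dt\<^sup>2 + exp (2t) \<langle>,\<rangle>\<close> on pairs \<open>(t, x)\<close>.\<close>

definition hyp_metric :: "(real \<times> (real^'m)) rmetric" where
  "hyp_metric p u v = fst u * fst v + exp (2 * fst p) * (snd u \<bullet> snd v)"

text \<open>The vector field \<open>exp t \<partial>\<^sub>t\<close>.\<close>

definition hyp_field :: "real \<times> (real^'m) \<Rightarrow> real \<times> (real^'m)" where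
  "hyp_field p = (exp (fst p), 0)"

definition graph_immersion :: "(real^'m \<Rightarrow> real) \<Rightarrow> real^'m \<Rightarrow> real \<times> (real^'m)" where
  "graph_immersion v x = (v x, x)"

end

theory Submission
  imports Defs
begin

text \<open>In the upper half space coordinate \<open>w = exp (- v)\<close> the soliton equation expresses the trace of
  \<open>D\<^sup>2 w\<close> against the positive matrix \<open>I - p p\<^sup>T / (exp (2 v) + p \<bullet> p)\<close>, \<open>p = \<nabla>v\<close>, as
  \<open>- exp v (m + c exp v)\<close>. The trace of this matrix is at most \<open>m\<close>, so at a minimum of
  \<open>w + \<epsilon> \<bar>x\<bar>\<^sup>2\<close>, where \<open>w\<close> does not exceed \<open>w 0\<close>, one gets \<open>exp v (m + c exp v) \<le> 2 \<epsilon> m\<close>.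
  Hence \<open>m + c exp v\<close> is not bounded below by a positive constant; the same argument for \<open>- w\<close>, when
  \<open>w\<close> is bounded, shows that it is not bounded above by a negative one. A graph at positive
  distance from the horosphere \<open>m + c exp t = 0\<close> would lie on one side of it and violate one of
  these.\<close>

section \<open>Second derivative test at approximate minima\<close>

text \<open>Since \<open>f' 0 = 0\<close>, a negative \<open>l\<close> would make \<open>f'\<close>
  negative just to the right of \<open>0\<close>, and \<open>f\<close> would drop below
  \<open>f 0\<close> there.\<close>

lemma second_derivative_nonneg_at_min:
  fixes f f' :: "real \<Rightarrow> real"
  assumes f: "\<And>s. (f has_real_derivative f' s) (at s)"
    and f': "(f' has_real_derivative l) (at 0)"
    and min: "\<And>s. f 0 \<le> f s"
  shows "0 \<le> l"
proof (rule ccontr)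
  assume "\<not> 0 \<le> l"
  then have "l < 0" by simp
  have f'0: "f' 0 = 0"
    using DERIV_local_min[OF f, of 1 0] min by simp
  obtain d where d: "d > 0" "\<And>h. 0 < h \<Longrightarrow> h < d \<Longrightarrow> f' h < 0"
    using DERIV_neg_dec_right[OF f' \<open>l < 0\<close>] f'0 by auto
  obtain z where "0 < z" "z < d/2" "f (d/2) - f 0 = (d/2 - 0) * f' z"
    using MVT2[of 0 "d/2" f f'] f d(1) by auto
  moreover have "d/2 * f' z < 0"
    using d(2)[of z] d(1) \<open>0 < z\<close> \<open>z < d/2\<close> by (simp add: mult_pos_neg)
  ultimately have "f (d/2) < f 0" by simp
  with min show False by (meson not_le)
qed

text \<open>A function bounded below need not attain its infimum on a noncompact space, but adding
  \<open>\<epsilon> * (x \<bullet> x)\<close> makes it coercive. At a minimum of the sum the test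
  along each line costs only the second derivative of the added term. Derivatives are assumed along
  lines, so that one-variable calculus suffices.\<close>

lemma approximate_minimum_principle:
  fixes f :: "'a::euclidean_space \<Rightarrow> real"
  assumes cont: "continuous_on UNIV f" and bdd: "\<And>x. B \<le> f x"
    and f1: "\<And>x b s. ((\<lambda>s. f (x + s *\<^sub>R b)) has_real_derivative f' (x + s *\<^sub>R b) b) (at s)"
    and f2: "\<And>x b. ((\<lambda>s. f' (x + s *\<^sub>R b) b) has_real_derivative f'' x b) (at 0)"
    and "\<epsilon> > 0"
  obtains x where "f x \<le> f 0" "\<And>b. - 2 * \<epsilon> * (b \<bullet> b) \<le> f'' x b"
proof -
  define h where "h x = f x + \<epsilon> * (x \<bullet> x)" for x
  \<comment> \<open>Beyond this radius \<open>\<epsilon> * (y \<bullet> y) > f 0 - B\<close>, so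
    \<open>h y > f 0 = h 0\<close> and the minimum over the ball is global.\<close>
  define R where "R = sqrt ((f 0 - B) / \<epsilon>)"
  have R: "0 \<le> R" "R\<^sup>2 = (f 0 - B) / \<epsilon>"
    using bdd[of 0] \<open>\<epsilon> > 0\<close> by (auto simp: R_def)
  have "continuous_on (cball 0 R) h"
    unfolding h_def by (intro continuous_intros continuous_on_subset[OF cont]) auto
  then obtain x where x: "x \<in> cball 0 R" "\<And>y. y \<in> cball 0 R \<Longrightarrow> h x \<le> h y"
    using continuous_attains_inf[of "cball 0 R" h] R by auto
  have hx0: "h x \<le> h 0" using x(2) R by simp
  have min: "h x \<le> h y" for y
  proof (cases "y \<in> cball 0 R")
    case False
    then have "R < norm y" by simp
    then have "R\<^sup>2 < y \<bullet> y"
      unfolding power2_norm_eq_inner[symmetric] using R(1) by (rule power_strict_mono) simp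
    then have "f 0 - B < \<epsilon> * (y \<bullet> y)"
      using R \<open>\<epsilon> > 0\<close> by (simp add: field_simps)
    then have "h 0 \<le> h y" using bdd[of y] by (simp add: h_def)
    with hx0 show ?thesis by simp
  qed (use x in auto)
  have "- 2 * \<epsilon> * (b \<bullet> b) \<le> f'' x b" for b
  proof -
    \<comment> \<open>\<open>h\<close> along the line, with the square expanded as a polynomial in
      \<open>s\<close> so that the derivative rules apply directly.\<close>
    let ?g = "\<lambda>s. f (x + s *\<^sub>R b) + \<epsilon> * (x \<bullet> x + 2 * s * (x \<bullet> b) + s\<^sup>2 * (b \<bullet> b))"
    let ?g' = "\<lambda>s. f' (x + s *\<^sub>R b) b + \<epsilon> * (2 * (x \<bullet> b) + 2 * s * (b \<bullet> b))"
    have g: "?g s = h (x + s *\<^sub>R b)" for s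
      by (simp add: h_def inner_simps inner_commute power2_eq_square algebra_simps)
    have "0 \<le> f'' x b + 2 * \<epsilon> * (b \<bullet> b)"
    proof (rule second_derivative_nonneg_at_min[of ?g ?g'])
      show "(?g has_real_derivative ?g' s) (at s)" for s
        by (rule derivative_eq_intros f1 refl | simp)+
      show "(?g' has_real_derivative f'' x b + 2 * \<epsilon> * (b \<bullet> b)) (at 0)"
        by (rule derivative_eq_intros f2 refl | simp)+
      show "?g 0 \<le> ?g s" for s unfolding g using min[of "x + s *\<^sub>R b"] by simp
    qed
    then show ?thesis by simp
  qed
  moreover have "f x \<le> f 0"
    using hx0 \<open>\<epsilon> > 0\<close> by (simp add: h_def) (smt (verit) inner_ge_zero mult_nonneg_nonneg)
  ultimately show thesis using that by blast
qed

section \<open>Connection and normal projection for the warped metric\<close>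

text \<open>Positive definiteness, tested on \<open>z - z'\<close>. It supplies the uniqueness
  behind the definite description in \<open>levi_civita\<close>.\<close>

lemma hyp_metric_eqI:
  assumes "\<And>w. hyp_metric p z w = hyp_metric p z' w"
  shows "z = z'"
proof -
  have "hyp_metric p (z - z') (z - z') = 0"
    using assms[of "z - z'"] by (simp add: hyp_metric_def algebra_simps)
  then have "(fst (z - z'))\<^sup>2 + exp (2 * fst p) * (norm (snd (z - z')))\<^sup>2 = 0"
    by (simp add: hyp_metric_def power2_eq_square flip: power2_norm_eq_inner)
  then have "fst (z - z') = 0 \<and> snd (z - z') = 0"
    by (smt (verit) exp_gt_zero mult_pos_pos norm_eq_zero zero_less_power2
        power_zero_numeral zero_le_power2 mult_nonneg_nonneg)
  then show ?thesis by (simp add: prod_eq_iff)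
qed

text \<open>The metric depends on the point only through \<open>exp (2 * fst p)\<close>, so each
  Koszul term is a derivative of this factor; the formula is read off by comparing
  components.\<close>

lemma levi_civita_hyp_metric:
  fixes p u v :: "real \<times> (real^'b)"
  shows "levi_civita hyp_metric p u v =
     (- exp (2 * fst p) * (snd u \<bullet> snd v), fst u *\<^sub>R snd v + fst v *\<^sub>R snd u)"
proof -
  have D: "frechet_derivative (\<lambda>q. hyp_metric q a b) (at p) z
      = 2 * fst z * exp (2 * fst p) * (snd a \<bullet> snd b)"
    for a b z :: "real \<times> (real^'b)"
  proof -
    have "((\<lambda>q. hyp_metric q a b) has_derivative
        (\<lambda>z. 2 * fst z * exp (2 * fst p) * (snd a \<bullet> snd b))) (at p)"
      unfolding hyp_metric_def
      by (auto intro!: derivative_eq_intros)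
    from frechet_derivative_at[OF this] show ?thesis by metis
  qed
  show ?thesis
    unfolding levi_civita_def D
  proof (rule the_equality)
    show z: "\<forall>w. 2 * hyp_metric p (- exp (2 * fst p) * (snd u \<bullet> snd v), fst u *\<^sub>R snd v + fst v *\<^sub>R snd u) w =
        2 * fst u * exp (2 * fst p) * (snd v \<bullet> snd w) + 2 * fst v * exp (2 * fst p) * (snd u \<bullet> snd w)
        - 2 * fst w * exp (2 * fst p) * (snd u \<bullet> snd v)"
      by (simp add: hyp_metric_def inner_simps algebra_simps)
    show "z = (- exp (2 * fst p) * (snd u \<bullet> snd v), fst u *\<^sub>R snd v + fst v *\<^sub>R snd u)"
      if "\<forall>w. 2 * hyp_metric p z w =
        2 * fst u * exp (2 * fst p) * (snd v \<bullet> snd w) + 2 * fst v * exp (2 * fst p) * (snd u \<bullet> snd w)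
        - 2 * fst w * exp (2 * fst p) * (snd u \<bullet> snd v)" for z
    proof (rule hyp_metric_eqI)
      fix w
      have "2 * hyp_metric p z w = 2 * hyp_metric p (- exp (2 * fst p) * (snd u \<bullet> snd v), fst u *\<^sub>R snd v + fst v *\<^sub>R snd u) w"
        using that z by presburger
      then show "hyp_metric p z w = hyp_metric p (- exp (2 * fst p) * (snd u \<bullet> snd v), fst u *\<^sub>R snd v + fst v *\<^sub>R snd u) w"
        by simp
    qed
  qed
qed

text \<open>The normal line of a graph with gradient \<open>p\<close> is spanned by
  \<open>(1, - (1 / E) *\<^sub>R p)\<close>. The coefficient is forced by the requirement that the
  remainder of \<open>w\<close> be tangent.\<close>

lemma normal_part_graph_hyp:
  fixes \<psi> :: "real^'m \<Rightarrow> real \<times> (real^'m)" and p :: "real^'m"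
  assumes D: "frechet_derivative \<psi> (at x) = (\<lambda>a. (p \<bullet> a, a))"
  defines "E \<equiv> exp (2 * fst (\<psi> x))"
  shows "normal_part hyp_metric \<psi> x w =
    ((fst w - p \<bullet> snd w) / (1 + (p \<bullet> p) / E)) *\<^sub>R (1, - (1 / E) *\<^sub>R p)"
proof -
  have E: "E > 0" by (simp add: E_def)
  then have Q: "1 + (p \<bullet> p) / E > 0"
    by (simp add: add_pos_nonneg)
  define r where "r = (fst w - p \<bullet> snd w) / (1 + (p \<bullet> p) / E)"
  have r: "r * (1 + (p \<bullet> p) / E) = fst w - p \<bullet> snd w"
    using Q by (simp add: r_def)
  show ?thesis
    unfolding normal_part_def D r_def[symmetric]
  proof (rule the_equality, intro conjI allI)
    show "hyp_metric (\<psi> x) (r *\<^sub>R (1, - (1 / E) *\<^sub>R p)) (p \<bullet> a, a) = 0" for a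
      using E by (simp add: hyp_metric_def flip: E_def)
    show "w - r *\<^sub>R (1, - (1 / E) *\<^sub>R p) \<in> range (\<lambda>a. (p \<bullet> a, a))"
      by (rule range_eqI[of _ _ "snd w + (r / E) *\<^sub>R p"])
        (use r in \<open>simp add: prod_eq_iff inner_simps algebra_simps\<close>)
    fix n assume n: "(\<forall>a. hyp_metric (\<psi> x) n (p \<bullet> a, a) = 0) \<and> w - n \<in> range (\<lambda>a. (p \<bullet> a, a))"
    \<comment> \<open>Orthogonality of \<open>n\<close> to the tangent vector of \<open>a\<close>
      reads \<open>?b \<bullet> a = 0\<close>; taking \<open>a = ?b\<close> gives
      \<open>?b = 0\<close>.\<close>
    let ?b = "fst n *\<^sub>R p + E *\<^sub>R snd n"
    have "?b \<bullet> ?b = 0"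
      using n[THEN conjunct1, rule_format, of ?b]
      unfolding hyp_metric_def E_def[symmetric] by (simp add: inner_simps algebra_simps)
    then have "E *\<^sub>R snd n = - fst n *\<^sub>R p"
      by (simp add: add_eq_0_iff2)
    then have "(1 / E) *\<^sub>R (E *\<^sub>R snd n) = (1 / E) *\<^sub>R (- fst n *\<^sub>R p)" by simp
    then have sn: "snd n = (- fst n / E) *\<^sub>R p" using E by simp
    have "fst w - fst n = p \<bullet> (snd w - snd n)"
      using n by (auto simp: prod_eq_iff)
    then have "fst n * (1 + (p \<bullet> p) / E) = fst w - p \<bullet> snd w"
      unfolding sn by (simp add: inner_simps algebra_simps)
    then have "fst n = r" using Q by (simp add: r_def nonzero_eq_divide_eq)
    then show "n = r *\<^sub>R (1, - (1 / E) *\<^sub>R p)"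
      using sn by (simp add: prod_eq_iff)
  qed
qed

section \<open>Inverse of the induced metric\<close>

lemma matrix_inv_unique:
  fixes A B :: "real^'n^'n"
  assumes "A ** B = mat 1"
  shows "matrix_inv A = B"
proof -
  have BA: "B ** A = mat 1" using assms matrix_left_right_inverse by blast
  have "A ** matrix_inv A = mat 1 \<and> matrix_inv A ** A = mat 1"
    unfolding matrix_inv_def by (rule someI[of _ B]) (use assms BA in simp)
  moreover have "matrix_inv A ** (A ** B) = (matrix_inv A ** A) ** B"
    by (rule matrix_mul_assoc)
  ultimately show ?thesis
    by (simp add: assms)
qed

text \<open>The Sherman-Morrison formula for \<open>E\<close> times the identity plus
  \<open>p\<close> times its transpose, which is the first fundamental matrix of a graph.\<close>

lemma matrix_inv_rank_one_update:
  fixes p :: "real^'n"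
  assumes "E > 0"
  shows "matrix_inv (\<chi> i j. p $ i * p $ j + E * (if i = j then 1 else 0)) =
    (\<chi> i j. ((if i = j then 1 else 0) - p $ i * p $ j / (E + p \<bullet> p)) / E)"
proof (rule matrix_inv_unique)
  let ?S = "E + p \<bullet> p"
  have S: "?S > 0" using assms by (simp add: add_pos_nonneg)
  \<comment> \<open>Splits a summand of the matrix product (\<open>x\<close>, \<open>y\<close>,
    \<open>z\<close> stand for entries of \<open>p\<close>, \<open>a\<close>, \<open>b\<close> for
    Kronecker deltas) into terms whose sums over \<open>k\<close> are immediate. The proof replaces
    \<open>?S\<close> by an atomic nonzero \<open>T\<close> so that the simplifier does not
    rearrange it.\<close>
  have expand: "(x * y + E * a) * ((b - y * z / ?S) / E) =
      (x / E) * (y * b) - (x * z / (?S * E)) * (y * y) + a * (b - y * z / ?S)" for x y z a b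
  proof -
    have "(x * y + E * a) * ((b - y * z / T) / E) =
        (x / E) * (y * b) - (x * z / (T * E)) * (y * y) + a * (b - y * z / T)" if "T \<noteq> 0" for T
      using assms that by (simp add: divide_simps) (simp add: algebra_simps)
    then show ?thesis using S by simp
  qed
  have "(\<Sum>k\<in>UNIV. (p $ i * p $ k + E * (if i = k then 1 else 0)) *
      (((if k = j then 1 else 0) - p $ k * p $ j / ?S) / E)) = (if i = j then 1 else 0)" (is "?l = _") for i j
  proof -
    have "?l = (\<Sum>k\<in>UNIV. (p $ i / E) * (p $ k * (if k = j then 1 else 0))
       - (p $ i * p $ j / (?S * E)) * (p $ k * p $ k)
       + (if i = k then 1 else 0) * ((if k = j then 1 else 0) - p $ k * p $ j / ?S))"
      by (simp only: expand)
    also have "\<dots> = (p $ i / E) * p $ j - (p $ i * p $ j / (?S * E)) * (p \<bullet> p)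
       + ((if i = j then 1 else 0) - p $ i * p $ j / ?S)"
      unfolding sum.distrib sum_subtractf sum_distrib_left[symmetric]
      by (simp add: inner_vec_def if_distrib[where f = "\<lambda>c. _ * c"] if_distrib[where f = "\<lambda>c. c * _"] cong: if_cong)
    also have "\<dots> = (if i = j then 1 else 0)"
    proof -
      have "x / E - x / (T * E) * (T - E) - x / T = 0" if "T \<noteq> 0" for x T
        using assms that by (simp add: field_simps)
      from this[of ?S "p $ i * p $ j"] show ?thesis using S by (simp add: algebra_simps)
    qed
    finally show ?thesis .
  qed
  then show "(\<chi> i j. p $ i * p $ j + E * (if i = j then 1 else 0)) **
     (\<chi> i j. ((if i = j then 1 else 0) - p $ i * p $ j / ?S) / E) = mat 1"
    by (simp add: matrix_matrix_mult_def mat_def vec_eq_iff)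
qed

section \<open>The soliton equation of a graph\<close>

text \<open>All normal vectors are multiples of \<open>(1, - (1 / E) *\<^sub>R p)\<close>, so the
  first component carries the whole vector equation. Both sides contain the factor
  \<open>1 / Q\<close> of the normal projection, which cancels.\<close>

lemma soliton_graph_equation:
  fixes v :: "real^'m \<Rightarrow> real" and x :: "real^'m"
  assumes v1: "\<And>y. v differentiable (at y)"
    and v2: "\<And>y a. (\<lambda>z. frechet_derivative v (at z) a) differentiable (at y)"
    and sol: "mcf_soliton hyp_metric hyp_field c (graph_immersion v)"
  defines "p \<equiv> (\<chi> i. frechet_derivative v (at x) (axis i 1))"
    and "H \<equiv> \<lambda>i j. frechet_derivative (\<lambda>y. frechet_derivative v (at y) (axis j 1)) (at x) (axis i 1)"
    and "E \<equiv> exp (2 * v x)"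
  shows "c * exp (v x) = (\<Sum>i\<in>UNIV. \<Sum>j\<in>UNIV.
    ((if i = j then 1 else 0) - p $ i * p $ j / (E + p \<bullet> p)) / E *
    (H i j - 2 * p $ i * p $ j - E * (if i = j then 1 else 0)))"
proof -
  let ?D = "\<lambda>y. frechet_derivative v (at y)"
  let ?\<psi> = "graph_immersion v"
  have E: "E > 0" by (simp add: E_def)
  have D\<psi>: "frechet_derivative ?\<psi> (at y) = (\<lambda>a. (?D y a, a))" for y
  proof -
    have "(v has_derivative ?D y) (at y)"
      using v1 frechet_derivative_works by blast
    then have "(?\<psi> has_derivative (\<lambda>a. (?D y a, a))) (at y)"
      unfolding graph_immersion_def by (auto intro!: derivative_eq_intros)
    from frechet_derivative_at[OF this] show ?thesis by metis
  qed
  have Dp: "?D x = (\<lambda>a. p \<bullet> a)"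
  proof
    fix a
    have lin: "linear (?D x)" by (rule linear_frechet_derivative) (rule v1)
    have "?D x a = ?D x (\<Sum>i\<in>UNIV. a $ i *\<^sub>R axis i 1)"
      using basis_expansion[of a] by (simp add: scalar_mult_eq_scaleR)
    also have "\<dots> = p \<bullet> a"
      unfolding linear_sum[OF lin] linear_cmul[OF lin] inner_vec_def p_def
      by (simp add: mult.commute)
    finally show "?D x a = p \<bullet> a" .
  qed
  have D2: "frechet_derivative (\<lambda>y. (?D y a, a)) (at x) b = (frechet_derivative (\<lambda>y. ?D y a) (at x) b, 0)"
    for a b :: "real^'m"
  proof -
    have "((\<lambda>y. ?D y a) has_derivative frechet_derivative (\<lambda>y. ?D y a) (at x)) (at x)"
      using v2 frechet_derivative_works by blast
    then have "((\<lambda>y. (?D y a, a)) has_derivative (\<lambda>b. (frechet_derivative (\<lambda>y. ?D y a) (at x) b, 0))) (at x)"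
      by (auto intro!: derivative_eq_intros)
    from frechet_derivative_at[OF this] show ?thesis by metis
  qed
  define Q where "Q = 1 + (p \<bullet> p) / E"
  have Q: "Q > 0" unfolding Q_def using E by (simp add: add_pos_nonneg)
  have fstx: "fst (?\<psi> x) = v x" by (simp add: graph_immersion_def)
  have D\<psi>x: "frechet_derivative ?\<psi> (at x) = (\<lambda>a. (p \<bullet> a, a))"
    unfolding D\<psi> Dp ..
  have NP: "normal_part hyp_metric ?\<psi> x w = ((fst w - p \<bullet> snd w) / Q) *\<^sub>R (1, - (1 / E) *\<^sub>R p)" for w
    using normal_part_graph_hyp[OF D\<psi>x] unfolding fstx Q_def E_def .
  have ax: "axis i 1 $ j = (if i = j then 1 else (0::real))" for i j :: 'm
    by (simp add: axis_def)
  \<comment> \<open>The Christoffel term adds \<open>- E\<close> times the Kronecker delta to the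
    first component; its second component, paired with \<open>p\<close>, gives
    \<open>- 2 * p $ i * p $ j\<close>.\<close>
  have II: "fst (second_fundamental_form hyp_metric ?\<psi> x (axis i 1) (axis j 1)) =
     (H i j - 2 * p $ i * p $ j - E * (if i = j then 1 else 0)) / Q" for i j
    unfolding second_fundamental_form_def levi_civita_hyp_metric D\<psi> D2 NP fstx Dp H_def E_def[symmetric]
    by (simp add: inner_axis ax inner_add_right add_divide_distrib diff_divide_distrib)
  have "first_fundamental_matrix hyp_metric ?\<psi> x = (\<chi> i j. p $ i * p $ j + E * (if i = j then 1 else 0))"
    unfolding first_fundamental_matrix_def D\<psi>x hyp_metric_def fstx E_def[symmetric]
    by (simp add: vec_eq_iff inner_axis ax)
  then have inv: "matrix_inv (first_fundamental_matrix hyp_metric ?\<psi> x) =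
      (\<chi> i j. ((if i = j then 1 else 0) - p $ i * p $ j / (E + p \<bullet> p)) / E)"
    using matrix_inv_rank_one_update[OF E, of p] by simp
  have "c *\<^sub>R normal_part hyp_metric ?\<psi> x (hyp_field (?\<psi> x)) =
     real CARD('m) *\<^sub>R mean_curvature_vector hyp_metric ?\<psi> x"
    using sol unfolding mcf_soliton_def by blast
  then have "fst (c *\<^sub>R normal_part hyp_metric ?\<psi> x (hyp_field (?\<psi> x))) =
     fst (real CARD('m) *\<^sub>R mean_curvature_vector hyp_metric ?\<psi> x)" by simp
  then have "c * exp (v x) / Q = (\<Sum>i\<in>UNIV. \<Sum>j\<in>UNIV.
      ((if i = j then 1 else 0) - p $ i * p $ j / (E + p \<bullet> p)) / E *
      ((H i j - 2 * p $ i * p $ j - E * (if i = j then 1 else 0)) / Q))"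
    unfolding mean_curvature_vector_def NP inv
    by (simp add: hyp_field_def fstx fst_sum II)
  also have "\<dots> = (\<Sum>i\<in>UNIV. \<Sum>j\<in>UNIV.
      ((if i = j then 1 else 0) - p $ i * p $ j / (E + p \<bullet> p)) / E *
      (H i j - 2 * p $ i * p $ j - E * (if i = j then 1 else 0))) / Q"
    by (simp add: sum_divide_distrib)
  finally show ?thesis using Q by simp
qed

text \<open>The \<open>b k\<close> are the columns of a symmetric square root, the identity minus
  \<open>\<beta>\<close> times \<open>p\<close> times its transpose. They turn a trace against the
  matrix on the right into a sum of second derivatives in the directions \<open>b k\<close>.\<close>

lemma rank_one_square_root:
  fixes p :: "real^'n"
  assumes "E > 0"
  obtains b :: "'n \<Rightarrow> real^'n"
  where "\<And>i j. (\<Sum>k\<in>UNIV. b k $ i * b k $ j) = (if i = j then 1 else 0) - p $ i * p $ j / (E + p \<bullet> p)"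
proof
  define S where "S = E + p \<bullet> p"
  \<comment> \<open>The smaller root of
    \<open>2 * \<beta> - \<beta>\<^sup>2 * (p \<bullet> p) = 1 / S\<close>, rationalized so that
    \<open>p = 0\<close> needs no separate case.\<close>
  define \<beta> where "\<beta> = 1 / (S + sqrt (E * S))"
  have S: "S > 0" using assms by (simp add: S_def add_pos_nonneg)
  have \<beta>: "2 * \<beta> - \<beta>\<^sup>2 * (p \<bullet> p) = 1 / S"
  proof -
    define r where "r = sqrt (E * S)"
    have r: "r * r = E * S" "r \<ge> 0" using S assms by (auto simp: r_def)
    have "S * (2 * (S + r) - (S - E)) = (S + r)\<^sup>2"
      using r by (simp add: power2_eq_square algebra_simps)
    moreover have "p \<bullet> p = S - E" by (simp add: S_def)
    moreover have "S + r > 0" using S r by simp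
    ultimately show ?thesis unfolding \<beta>_def r_def[symmetric] using S
      by (simp add: divide_simps power2_eq_square) (simp add: algebra_simps)
  qed
  let ?b = "\<lambda>k. axis k 1 - (\<beta> * p $ k) *\<^sub>R p"
  fix i j
  have "(\<Sum>k\<in>UNIV. ?b k $ i * ?b k $ j) = (\<Sum>k\<in>UNIV. (if i = k then 1 else 0) * (if j = k then 1 else 0)
     - \<beta> * p $ j * ((if i = k then 1 else 0) * p $ k)
     - \<beta> * p $ i * ((if j = k then 1 else 0) * p $ k) + \<beta>\<^sup>2 * p $ i * p $ j * (p $ k * p $ k))"
    by (intro sum.cong refl) (simp add: axis_def power2_eq_square algebra_simps)
  also have "\<dots> = (if i = j then 1 else 0) - (2 * \<beta> - \<beta>\<^sup>2 * (p \<bullet> p)) * (p $ i * p $ j)"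
    unfolding sum.distrib sum_subtractf sum_distrib_left[symmetric]
    by (simp add: inner_vec_def algebra_simps if_distrib[where f = "\<lambda>c. c * _"]
        if_distrib[where f = "\<lambda>c. _ * c"] cong: if_cong)
  finally show "(\<Sum>k\<in>UNIV. ?b k $ i * ?b k $ j) = (if i = j then 1 else 0) - p $ i * p $ j / (E + p \<bullet> p)"
    unfolding \<beta> by (simp add: S_def)
qed

text \<open>The summands are the second derivatives of \<open>exp (- v)\<close> at \<open>x\<close> in the directions \<open>b k\<close>.\<close>

lemma soliton_graph_frame:
  fixes v :: "real^'m \<Rightarrow> real" and x :: "real^'m"
  assumes v1: "\<And>y. v differentiable (at y)"
    and v2: "\<And>y a. (\<lambda>z. frechet_derivative v (at z) a) differentiable (at y)"
    and sol: "mcf_soliton hyp_metric hyp_field c (graph_immersion v)"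
  obtains b :: "'m \<Rightarrow> real^'m" where "(\<Sum>k\<in>UNIV. b k \<bullet> b k) \<le> real CARD('m)"
    and "(\<Sum>k\<in>UNIV. exp (- v x) * ((frechet_derivative v (at x) (b k))\<^sup>2 -
        frechet_derivative (\<lambda>y. frechet_derivative v (at y) (b k)) (at x) (b k))) =
      - exp (v x) * (real CARD('m) + c * exp (v x))"
proof -
  let ?D = "\<lambda>y. frechet_derivative v (at y)"
  define p where "p = (\<chi> i. ?D x (axis i 1))"
  define H where "H i j = frechet_derivative (\<lambda>y. ?D y (axis j 1)) (at x) (axis i 1)" for i j
  define E where "E = exp (2 * v x)"
  define A where "A i j = (if i = j then 1 else 0) - p $ i * p $ j / (E + p \<bullet> p)" for i j
  have E: "E > 0" by (simp add: E_def)
  then have S: "E + p \<bullet> p > 0" by (simp add: add_pos_nonneg)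
  obtain b :: "'m \<Rightarrow> real^'m" where b: "\<And>i j. (\<Sum>k\<in>UNIV. b k $ i * b k $ j) = A i j"
    by (rule rank_one_square_root[OF E, of p, folded A_def], rule that)
  have expand: "?D y a = (\<Sum>i\<in>UNIV. a $ i * ?D y (axis i 1))" for y a
  proof -
    have lin: "linear (?D y)" by (rule linear_frechet_derivative) (rule v1)
    have "?D y a = ?D y (\<Sum>i\<in>UNIV. a $ i *\<^sub>R axis i 1)"
      using basis_expansion[of a] by (simp add: scalar_mult_eq_scaleR)
    then show ?thesis
      unfolding linear_sum[OF lin] linear_cmul[OF lin] by simp
  qed
  have expand2: "frechet_derivative (\<lambda>y. ?D y a) (at x) a = (\<Sum>i\<in>UNIV. \<Sum>j\<in>UNIV. a $ i * a $ j * H i j)" for a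
  proof -
    have lin: "linear (frechet_derivative (\<lambda>y. ?D y e) (at x))" for e
      by (rule linear_frechet_derivative) (rule v2)
    have "((\<lambda>y. ?D y e) has_derivative frechet_derivative (\<lambda>y. ?D y e) (at x)) (at x)" for e
      using v2 frechet_derivative_works by blast
    then have "((\<lambda>y. \<Sum>j\<in>UNIV. a $ j * ?D y (axis j 1)) has_derivative
        (\<lambda>z. \<Sum>j\<in>UNIV. a $ j * frechet_derivative (\<lambda>y. ?D y (axis j 1)) (at x) z)) (at x)"
      by (intro has_derivative_sum has_derivative_mult_right)
    from frechet_derivative_at[OF this]
    have "frechet_derivative (\<lambda>y. ?D y a) (at x) a =
        (\<Sum>j\<in>UNIV. a $ j * frechet_derivative (\<lambda>y. ?D y (axis j 1)) (at x) a)"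
      unfolding expand[of _ a] by (rule fun_cong[OF sym])
    also have "\<dots> = (\<Sum>j\<in>UNIV. a $ j * (\<Sum>i\<in>UNIV. a $ i * H i j))"
    proof (intro sum.cong refl arg_cong2[where f = "(*)"])
      fix j
      have "frechet_derivative (\<lambda>y. ?D y (axis j 1)) (at x) a =
          frechet_derivative (\<lambda>y. ?D y (axis j 1)) (at x) (\<Sum>i\<in>UNIV. a $ i *\<^sub>R axis i 1)"
        using basis_expansion[of a] by (simp add: scalar_mult_eq_scaleR)
      then show "frechet_derivative (\<lambda>y. ?D y (axis j 1)) (at x) a = (\<Sum>i\<in>UNIV. a $ i * H i j)"
        unfolding linear_sum[OF lin] linear_cmul[OF lin] H_def by simp
    qed
    also have "\<dots> = (\<Sum>i\<in>UNIV. \<Sum>j\<in>UNIV. a $ i * a $ j * H i j)"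
      unfolding sum_distrib_left by (subst sum.swap) (simp add: mult_ac)
    finally show ?thesis .
  qed
  \<comment> \<open>The Hessian of \<open>exp (- v)\<close>, evaluated on \<open>(a, a)\<close> and
    written in coordinates.\<close>
  have quad: "exp (- v x) * ((?D x a)\<^sup>2 - frechet_derivative (\<lambda>y. ?D y a) (at x) a) =
      (\<Sum>i\<in>UNIV. \<Sum>j\<in>UNIV. (- exp (- v x) * (H i j - p $ i * p $ j)) * (a $ i * a $ j))" for a
  proof -
    have sq: "(?D x a)\<^sup>2 = (\<Sum>i\<in>UNIV. \<Sum>j\<in>UNIV. a $ i * a $ j * (p $ i * p $ j))"
      unfolding expand[of x a] power2_eq_square sum_product by (simp add: p_def mult_ac)
    show ?thesis
      unfolding sq expand2 sum_subtractf[symmetric] sum_distrib_left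
      by (intro sum.cong refl) (simp add: algebra_simps)
  qed
  have "(\<Sum>k\<in>UNIV. exp (- v x) * ((?D x (b k))\<^sup>2 - frechet_derivative (\<lambda>y. ?D y (b k)) (at x) (b k))) =
      (\<Sum>i\<in>UNIV. \<Sum>k\<in>UNIV. \<Sum>j\<in>UNIV. (- exp (- v x) * (H i j - p $ i * p $ j)) * (b k $ i * b k $ j))"
    unfolding quad by (rule sum.swap)
  also have "\<dots> = (\<Sum>i\<in>UNIV. \<Sum>j\<in>UNIV. (- exp (- v x) * (H i j - p $ i * p $ j)) * A i j)"
    unfolding b[symmetric] sum_distrib_left by (intro sum.cong refl sum.swap)
  also have "\<dots> = - exp (- v x) * (\<Sum>i\<in>UNIV. \<Sum>j\<in>UNIV. A i j * (H i j - p $ i * p $ j))"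
    unfolding sum_distrib_left by (simp add: mult_ac)
  finally have lhs: "(\<Sum>k\<in>UNIV. exp (- v x) * ((?D x (b k))\<^sup>2 - frechet_derivative (\<lambda>y. ?D y (b k)) (at x) (b k))) =
      - exp (- v x) * (\<Sum>i\<in>UNIV. \<Sum>j\<in>UNIV. A i j * (H i j - p $ i * p $ j))" .
  \<comment> \<open>\<open>A i j / E\<close> are the entries of the inverse of the matrix paired
    with \<open>A\<close> here, so the sum is \<open>E\<close> times the trace of the
    identity.\<close>
  have trace: "(\<Sum>i\<in>UNIV. \<Sum>j\<in>UNIV. A i j * (p $ i * p $ j + E * (if i = j then 1 else 0))) = E * real CARD('m)"
  proof -
    let ?S = "E + p \<bullet> p"
    have "(\<Sum>j\<in>UNIV. A i j * (p $ i * p $ j + E * (if i = j then 1 else 0))) =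
        (\<Sum>j\<in>UNIV. (if i = j then p $ i * p $ j + E - E / ?S * (p $ i * p $ j) else 0)
          - (p $ i * p $ i / ?S) * (p $ j * p $ j))" for i
      by (intro sum.cong refl) (simp add: A_def algebra_simps)
    also have "\<dots> i = p $ i * p $ i + E - E / ?S * (p $ i * p $ i) - (p $ i * p $ i / ?S) * (p \<bullet> p)" for i
      unfolding sum_subtractf sum_distrib_left[symmetric] by (simp add: inner_vec_def)
    also have "\<dots> i = E + (1 - E / ?S - (p \<bullet> p) / ?S) * (p $ i * p $ i)" for i
      by (simp add: algebra_simps)
    finally have "(\<Sum>j\<in>UNIV. A i j * (p $ i * p $ j + E * (if i = j then 1 else 0))) =
        E + (1 - E / ?S - (p \<bullet> p) / ?S) * (p $ i * p $ i)" for i .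
    moreover have "1 - E / ?S - (p \<bullet> p) / ?S = 0"
      using S by (simp add: divide_simps)
    ultimately show ?thesis by simp
  qed
  have "c * exp (v x) = (\<Sum>i\<in>UNIV. \<Sum>j\<in>UNIV. A i j / E *
      (H i j - 2 * p $ i * p $ j - E * (if i = j then 1 else 0)))"
    using soliton_graph_equation[OF v1 v2 sol, of x] unfolding p_def H_def E_def A_def .
  then have "E * (c * exp (v x)) = (\<Sum>i\<in>UNIV. \<Sum>j\<in>UNIV. A i j *
      (H i j - 2 * p $ i * p $ j - E * (if i = j then 1 else 0)))"
    using E by (simp add: sum_distrib_left)
  \<comment> \<open>One of the two copies of \<open>p $ i * p $ j\<close> completes the Hessian of
    \<open>exp (- v)\<close>, the other completes the induced metric.\<close>
  also have "\<dots> = (\<Sum>i\<in>UNIV. \<Sum>j\<in>UNIV. A i j * (H i j - p $ i * p $ j)) -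
      (\<Sum>i\<in>UNIV. \<Sum>j\<in>UNIV. A i j * (p $ i * p $ j + E * (if i = j then 1 else 0)))"
    unfolding sum_subtractf[symmetric] by (intro sum.cong refl) (simp add: algebra_simps)
  finally have "(\<Sum>i\<in>UNIV. \<Sum>j\<in>UNIV. A i j * (H i j - p $ i * p $ j)) =
      E * (real CARD('m) + c * exp (v x))"
    unfolding trace by (simp add: algebra_simps)
  moreover have "exp (- v x) * E = exp (v x)"
    by (simp add: E_def flip: exp_add)
  ultimately have 2: "(\<Sum>k\<in>UNIV. exp (- v x) * ((?D x (b k))\<^sup>2 -
      frechet_derivative (\<lambda>y. ?D y (b k)) (at x) (b k))) = - exp (v x) * (real CARD('m) + c * exp (v x))"
    unfolding lhs by (metis mult.assoc mult_minus_left)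
  \<comment> \<open>The sum of squared lengths is the trace of \<open>A\<close>, whose diagonal
    entries are at most \<open>1\<close>.\<close>
  have "(\<Sum>k\<in>UNIV. b k \<bullet> b k) = (\<Sum>i\<in>UNIV. A i i)"
    unfolding inner_vec_def inner_real_def b[symmetric] by (rule sum.swap)
  also have "\<dots> \<le> (\<Sum>i\<in>(UNIV :: 'm set). 1)"
    using S by (intro sum_mono) (simp add: A_def)
  finally have "(\<Sum>k\<in>UNIV. b k \<bullet> b k) \<le> real CARD('m)" by simp
  from that[OF this 2] show thesis .
qed

section \<open>Lengths and distances in the warped metric\<close>

text \<open>Holds for arbitrary \<open>\<gamma>\<close>: if the speed is not integrable,
  \<open>integral\<close> takes the value \<open>0\<close>.\<close>

lemma curve_length_hyp_nonneg: "0 \<le> curve_length hyp_metric \<gamma>"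
  unfolding curve_length_def
  by (cases "(\<lambda>s. sqrt (hyp_metric (\<gamma> s) (vector_derivative \<gamma> (at s)) (vector_derivative \<gamma> (at s))))
      integrable_on {0..1}")
    (auto simp: not_integrable_integral hyp_metric_def intro!: integral_nonneg)

text \<open>Segments are admissible competitors, so the infimum in \<open>riem_dist\<close> is over
  a nonempty set.\<close>

lemma segment_C1:
  fixes p q :: "'a::euclidean_space"
  shows "linepath p q C1_differentiable_on {0..1}"
  by (auto simp: linepath_def C1_differentiable_on_def intro!: exI[of _ "\<lambda>_. q - p"] derivative_eq_intros)

lemma riem_dist_hyp_nonneg: "0 \<le> riem_dist hyp_metric p q"
  unfolding riem_dist_def
proof (rule cInf_greatest)
  show "{curve_length hyp_metric \<gamma> |\<gamma>. \<gamma> C1_differentiable_on {0..1} \<and> pathstart \<gamma> = p \<and> pathfinish \<gamma> = q} \<noteq> {}"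
    using segment_C1[of p q] pathstart_linepath pathfinish_linepath by fast
qed (use curve_length_hyp_nonneg in auto)

text \<open>The velocity of a vertical segment has no component along the horosphere, so the warping
  factor does not enter its length.\<close>

lemma riem_dist_vertical_le: "riem_dist hyp_metric (t, x) (t', x) \<le> \<bar>t - t'\<bar>"
proof -
  have v: "vector_derivative (linepath (t, x) (t', x)) (at s) = (t' - t, 0)" for s
    using vector_derivative_linepath_at[of "(t,x)" "(t',x)" s] by simp
  have "curve_length hyp_metric (linepath (t, x) (t', x)) = \<bar>t - t'\<bar>"
    unfolding curve_length_def v by (simp add: hyp_metric_def abs_minus_commute)
  then show ?thesis
    unfolding riem_dist_def
    using segment_C1[of "(t,x)" "(t',x)"]
    by (intro cInf_lower bdd_belowI[of _ 0])
      (auto simp: curve_length_hyp_nonneg intro!: exI[of _ "linepath (t, x) (t', x)"])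
qed

section \<open>Estimates for entire soliton graphs\<close>

text \<open>The approximate minimum principle for \<open>\<sigma> * exp (- v x)\<close>, summed over
  the frame of \<open>soliton_graph_frame\<close>. The values \<open>1\<close> and \<open>-1\<close>
  of \<open>\<sigma>\<close> serve the two one-sided bounds below.\<close>

lemma soliton_graph_estimate:
  fixes v :: "real^'m \<Rightarrow> real"
  assumes v: "smooth v" and sol: "mcf_soliton hyp_metric hyp_field c (graph_immersion v)"
    and bdd: "\<And>x. B \<le> \<sigma> * exp (- v x)" and \<epsilon>: "\<epsilon> > 0"
  obtains x where "\<sigma> * exp (- v x) \<le> \<sigma> * exp (- v 0)"
    and "\<sigma> * (exp (v x) * (real CARD('m) + c * exp (v x))) \<le> 2 * \<epsilon> * real CARD('m)"
proof -
  let ?D = "\<lambda>y. frechet_derivative v (at y)"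
  let ?H = "\<lambda>x b. frechet_derivative (\<lambda>y. ?D y b) (at x) b"
  have "C_k (Suc (Suc 0)) v" using v unfolding smooth_def by blast
  then have v1: "v differentiable (at y)" and v2: "(\<lambda>z. ?D z a) differentiable (at y)" for y a
    by (auto simp: differentiable_on_def)
  have line: "((\<lambda>s. g (x + s *\<^sub>R b)) has_real_derivative frechet_derivative g (at (x + s *\<^sub>R b)) b) (at s)"
    if "g differentiable (at (x + s *\<^sub>R b))" for g :: "real^'m \<Rightarrow> real" and x b s
  proof -
    have g: "(g has_derivative frechet_derivative g (at (x + s *\<^sub>R b))) (at (x + s *\<^sub>R b))"
      using that frechet_derivative_works by blast
    have "((\<lambda>s. x + s *\<^sub>R b) has_derivative (\<lambda>h. h *\<^sub>R b)) (at s)"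
      by (auto intro!: derivative_eq_intros)
    from has_derivative_compose[OF this g] show ?thesis
      by (simp add: has_field_derivative_def linear_cmul[OF linear_frechet_derivative[OF that]] mult.commute[of _ "frechet_derivative g (at (x + s *\<^sub>R b)) b"])
  qed
  obtain x where x: "\<sigma> * exp (- v x) \<le> \<sigma> * exp (- v 0)"
      "\<And>b. - 2 * \<epsilon> * (b \<bullet> b) \<le> \<sigma> * (exp (- v x) * ((?D x b)\<^sup>2 - ?H x b))"
  proof (rule approximate_minimum_principle[of "\<lambda>x. \<sigma> * exp (- v x)" B
        "\<lambda>x b. - \<sigma> * exp (- v x) * ?D x b"
        "\<lambda>x b. \<sigma> * (exp (- v x) * ((?D x b)\<^sup>2 - ?H x b))"])
    have "continuous_on UNIV v"
      by (simp add: continuous_on_eq_continuous_at differentiable_imp_continuous_within v1)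
    then show "continuous_on UNIV (\<lambda>x. \<sigma> * exp (- v x))"
      by (intro continuous_intros)
    show "((\<lambda>s. \<sigma> * exp (- v (x + s *\<^sub>R b))) has_real_derivative
        - \<sigma> * exp (- v (x + s *\<^sub>R b)) * ?D (x + s *\<^sub>R b) b) (at s)" for x b s
      by (rule derivative_eq_intros line v1 refl | simp)+
    show "((\<lambda>s. - \<sigma> * exp (- v (x + s *\<^sub>R b)) * ?D (x + s *\<^sub>R b) b) has_real_derivative
        \<sigma> * (exp (- v x) * ((?D x b)\<^sup>2 - ?H x b))) (at 0)" for x b
    proof -
      have 1: "((\<lambda>s. v (x + s *\<^sub>R b)) has_real_derivative ?D x b) (at 0)"
        using line[where g = v and x = x and s = 0 and b = b] v1 by simp
      have 2: "((\<lambda>s. ?D (x + s *\<^sub>R b) b) has_real_derivative ?H x b) (at 0)"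
        using line[where g = "\<lambda>z. ?D z b" and x = x and s = 0 and b = b] v2 by simp
      show ?thesis
        by (rule derivative_eq_intros 1 2 refl | simp add: power2_eq_square algebra_simps)+
    qed
  qed (use bdd \<epsilon> in auto)
  \<comment> \<open>The inequality at \<open>x\<close> holds in every direction, so the frame may be
    chosen after \<open>x\<close>.\<close>
  obtain b :: "'m \<Rightarrow> real^'m" where b: "(\<Sum>k\<in>UNIV. b k \<bullet> b k) \<le> real CARD('m)"
      "(\<Sum>k\<in>UNIV. exp (- v x) * ((?D x (b k))\<^sup>2 - ?H x (b k))) =
        - exp (v x) * (real CARD('m) + c * exp (v x))"
    by (rule soliton_graph_frame[OF v1 v2 sol, where x = x])
  have "- 2 * \<epsilon> * (\<Sum>k\<in>UNIV. b k \<bullet> b k) \<le>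
      \<sigma> * (\<Sum>k\<in>UNIV. exp (- v x) * ((?D x (b k))\<^sup>2 - ?H x (b k)))"
    unfolding sum_distrib_left by (intro sum_mono x(2))
  moreover have "2 * \<epsilon> * (\<Sum>k\<in>UNIV. b k \<bullet> b k) \<le> 2 * \<epsilon> * real CARD('m)"
    using b(1) \<epsilon> by simp
  ultimately show thesis using that[OF x(1)] unfolding b(2) by simp
qed

text \<open>With \<open>\<sigma> = 1\<close> the function \<open>exp (- v x)\<close> is bounded
  below by \<open>0\<close>, and comparison with the origin gives \<open>v x \<ge> v 0\<close> at
  the chosen point.\<close>

lemma soliton_graph_not_uniformly_below:
  fixes v :: "real^'m \<Rightarrow> real"
  assumes v: "smooth v" and sol: "mcf_soliton hyp_metric hyp_field c (graph_immersion v)"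
    and "\<kappa> > 0"
  shows "\<exists>x. real CARD('m) + c * exp (v x) < \<kappa>"
proof (rule ccontr)
  assume "\<not> ?thesis"
  then have \<kappa>: "\<kappa> \<le> real CARD('m) + c * exp (v x)" for x by (simp add: not_less)
  \<comment> \<open>Makes \<open>2 * \<epsilon> * real CARD('m)\<close> half of the lower bound
    \<open>exp (v 0) * \<kappa>\<close>.\<close>
  define \<epsilon> where "\<epsilon> = exp (v 0) * \<kappa> / (4 * real CARD('m))"
  have "\<epsilon> > 0" using \<open>\<kappa> > 0\<close> by (simp add: \<epsilon>_def)
  obtain x where x: "1 * exp (- v x) \<le> 1 * exp (- v 0)"
      "1 * (exp (v x) * (real CARD('m) + c * exp (v x))) \<le> 2 * \<epsilon> * real CARD('m)"
    by (rule soliton_graph_estimate[OF v sol, of 0 1]) (use \<open>\<epsilon> > 0\<close> in auto)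
  have "exp (v 0) * \<kappa> \<le> exp (v x) * (real CARD('m) + c * exp (v x))"
    using x(1) \<kappa>[of x] \<open>\<kappa> > 0\<close> by (intro mult_mono) auto
  also have "\<dots> \<le> exp (v 0) * \<kappa> / 2" using x(2) by (simp add: \<epsilon>_def mult.commute)
  also have "\<dots> < exp (v 0) * \<kappa>" using \<open>\<kappa> > 0\<close> by simp
  finally show False by simp
qed

text \<open>With \<open>\<sigma> = -1\<close> the bound \<open>B\<close> acts twice: it bounds
  \<open>- exp (- v x)\<close> below, and it keeps \<open>exp (v x)\<close> away from
  \<open>0\<close> at the chosen point.\<close>

lemma soliton_graph_not_uniformly_above:
  fixes v :: "real^'m \<Rightarrow> real"
  assumes v: "smooth v" and sol: "mcf_soliton hyp_metric hyp_field c (graph_immersion v)"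
    and "\<kappa> > 0" and B: "\<And>x. B \<le> v x"
  shows "\<exists>x. - \<kappa> < real CARD('m) + c * exp (v x)"
proof (rule ccontr)
  assume "\<not> ?thesis"
  then have \<kappa>: "\<kappa> \<le> - (real CARD('m) + c * exp (v x))" for x by (smt (verit))
  define \<epsilon> where "\<epsilon> = exp B * \<kappa> / (4 * real CARD('m))"
  have "\<epsilon> > 0" using \<open>\<kappa> > 0\<close> by (simp add: \<epsilon>_def)
  obtain x where x: 
      "(-1) * (exp (v x) * (real CARD('m) + c * exp (v x))) \<le> 2 * \<epsilon> * real CARD('m)"
    by (rule soliton_graph_estimate[OF v sol, of "- exp (- B)" "-1"]) (use \<open>\<epsilon> > 0\<close> B in auto)
  have "exp B * \<kappa> \<le> exp (v x) * (- (real CARD('m) + c * exp (v x)))"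
    using B[of x] \<kappa>[of x] \<open>\<kappa> > 0\<close> by (intro mult_mono) auto
  also have "\<dots> \<le> exp B * \<kappa> / 2" using x by (simp add: \<epsilon>_def algebra_simps)
  also have "\<dots> < exp B * \<kappa>" using \<open>\<kappa> > 0\<close> by simp
  finally show False by simp
qed

text \<open>By connectedness of its range, a \<open>v\<close> that stays at distance
  \<open>e\<close> from \<open>t\<close> lies entirely on one side of \<open>t\<close>. As
  \<open>c * exp t = - real CARD('m)\<close>, this gives the soliton expression a uniform sign,
  which the two preceding lemmas exclude.\<close>

lemma soliton_graph_near_horosphere:
  fixes v :: "real^'m \<Rightarrow> real"
  assumes v: "smooth v" and sol: "mcf_soliton hyp_metric hyp_field c (graph_immersion v)"
    and "c < 0" and "e > 0"
  defines "t \<equiv> ln (- (real CARD('m) / c))"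
  shows "\<exists>x. \<bar>v x - t\<bar> < e"
proof (rule ccontr)
  assume "\<not> ?thesis"
  then have far: "e \<le> \<bar>v x - t\<bar>" for x by (simp add: not_less)
  have t: "c * exp t = - real CARD('m)"
    using \<open>c < 0\<close> by (simp add: t_def divide_neg_pos zero_less_divide_iff divide_less_0_iff)
  have "C_k 0 v" using v unfolding smooth_def by blast
  then have conn: "connected (range v)"
    by (intro connected_continuous_image) auto
  have "(\<forall>x. v x \<le> t - e) \<or> (\<forall>x. t + e \<le> v x)"
  proof (rule ccontr)
    assume "\<not> ?thesis"
    then obtain x y where "t - e < v x" "v y < t + e" by (auto simp: not_le)
    then have "v y \<le> t" "t \<le> v x" using far[of x] far[of y] \<open>e > 0\<close> by auto
    then have "t \<in> range v" using conn unfolding connected_iff_interval by blast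
    then obtain z where "t = v z" by blast
    then show False using far[of z] \<open>e > 0\<close> by simp
  qed
  then show False
  proof
    assume below: "\<forall>x. v x \<le> t - e"
    have "real CARD('m) * (1 - exp (- e)) \<le> real CARD('m) + c * exp (v x)" for x
    proof -
      have "c * exp (t - e) \<le> c * exp (v x)" using below \<open>c < 0\<close> by simp
      moreover have "c * exp (t - e) = - real CARD('m) * exp (- e)"
        unfolding t[symmetric] by (simp add: exp_diff exp_minus divide_inverse)
      ultimately show ?thesis by (simp add: algebra_simps)
    qed
    then show False
      using soliton_graph_not_uniformly_below[OF v sol, of "real CARD('m) * (1 - exp (- e))"] \<open>e > 0\<close>
      by (auto simp: not_less[symmetric])
  next
    \<comment> \<open>On this side \<open>v\<close> is bounded below by \<open>t + e\<close>, the
      bound that the second estimate asks for.\<close>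
    assume above: "\<forall>x. t + e \<le> v x"
    have "real CARD('m) + c * exp (v x) \<le> - (real CARD('m) * (exp e - 1))" for x
    proof -
      have "c * exp (v x) \<le> c * exp (t + e)" using above \<open>c < 0\<close> by simp
      moreover have "c * exp (t + e) = - real CARD('m) * exp e"
        unfolding t[symmetric] by (simp add: exp_add)
      ultimately show ?thesis by (simp add: algebra_simps)
    qed
    then show False
      using soliton_graph_not_uniformly_above[OF v sol, of "real CARD('m) * (exp e - 1)" "t + e"] above \<open>e > 0\<close>
      by (auto simp: not_less[symmetric])
  qed
qed

section \<open>Nonexistence for \<open>c \<ge> 0\<close> and distance to the horosphere for
  \<open>c < 0\<close>\<close>

theorem corollary6:
  fixes c :: real
  shows "(c \<ge> 0 \<longrightarrow>
           \<not> (\<exists>v :: real^'m \<Rightarrow> real.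
                smooth v \<and> mcf_soliton hyp_metric hyp_field c (graph_immersion v)))
       \<and> (c < 0 \<longrightarrow>
           (\<forall>v :: real^'m \<Rightarrow> real.
              smooth v \<and> mcf_soliton hyp_metric hyp_field c (graph_immersion v) \<longrightarrow>
              riem_setdist hyp_metric (range (graph_immersion v))
                {p. fst p = ln (- (real CARD('m) / c))} = 0))"
proof (intro conjI impI allI)
  assume "c \<ge> 0"
  show "\<not> (\<exists>v :: real^'m \<Rightarrow> real. smooth v \<and> mcf_soliton hyp_metric hyp_field c (graph_immersion v))"
  proof
    assume "\<exists>v :: real^'m \<Rightarrow> real. smooth v \<and> mcf_soliton hyp_metric hyp_field c (graph_immersion v)"
    then obtain v :: "real^'m \<Rightarrow> real"
      where v: "smooth v" "mcf_soliton hyp_metric hyp_field c (graph_immersion v)" by blast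
    \<comment> \<open>With \<open>\<kappa> = real CARD('m)\<close> the estimate yields a point where
      \<open>c * exp (v x) < 0\<close>.\<close>
    obtain x where "real CARD('m) + c * exp (v x) < real CARD('m)"
      using soliton_graph_not_uniformly_below[OF v, of "real CARD('m)"] by auto
    then show False using \<open>c \<ge> 0\<close> by (simp add: mult_less_0_iff)
  qed
next
  fix v :: "real^'m \<Rightarrow> real"
  assume "c < 0" and v: "smooth v \<and> mcf_soliton hyp_metric hyp_field c (graph_immersion v)"
  define t where "t = ln (- (real CARD('m) / c))"
  let ?S = "{riem_dist hyp_metric p q | p q. p \<in> range (graph_immersion v) \<and> q \<in> {p. fst p = t}}"
  \<comment> \<open>Each graph point is paired with the point of the horosphere vertically above or
    below it.\<close>
  have mem: "riem_dist hyp_metric (v x, x) (t, x) \<in> ?S" for x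
    by (auto simp: graph_immersion_def intro!: exI[of _ "(v x, x)"] exI[of _ "(t, x)"] image_eqI[of _ _ x])
  have "Inf ?S = 0"
  proof (rule antisym)
    show "0 \<le> Inf ?S"
      by (rule cInf_greatest) (use mem riem_dist_hyp_nonneg in blast)+
    show "Inf ?S \<le> 0"
    proof (rule field_le_epsilon)
      fix e :: real assume "e > 0"
      obtain x where x: "\<bar>v x - t\<bar> < e"
        using soliton_graph_near_horosphere[of v c e] v \<open>c < 0\<close> \<open>e > 0\<close> unfolding t_def by blast
      have "Inf ?S \<le> riem_dist hyp_metric (v x, x) (t, x)"
        by (rule cInf_lower[OF mem]) (auto intro!: bdd_belowI[of _ 0] riem_dist_hyp_nonneg)
      also have "\<dots> \<le> \<bar>v x - t\<bar>" by (rule riem_dist_vertical_le)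
      finally show "Inf ?S \<le> 0 + e" using x by simp
    qed
  qed
  then show "riem_setdist hyp_metric (range (graph_immersion v)) {p. fst p = ln (- (real CARD('m) / c))} = 0"
    unfolding riem_setdist_def t_def .
qed

end
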